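(* Assume that $V\in\mathcal C^1(\mathbb R^m,\mathbb R)$. Let $h>0$ be an arbitrary step size which is sufficiently small for the implicit drift-preserving scheme $$\Psi_{n+1}=p_n+\Sigma\Delta W_n-\frac h2\int_0^1V'(q_n+sh\Psi_{n+1})\,ds,\quad q_{n+1}=q_n+h\Psi_{n+1},\quad p_{n+1}=p_n+\Sigma\Delta W_n-h\int_0^1V'(q_n+sh\Psi_{n+1})\,ds$$ to be solvable, and let $(p_n,q_n)_{n\ge0}$ be the numerical solution started from $(p_0,q_0)$, where $\mathbb E[H(p_0,q_0)]<+\infty$. Then $$\mathbb E[H(p_n,q_n)]=\mathbb E[H(p_0,q_0)]+\frac12\operatorname{Tr}(\Sigma^\top\Sigma)\,t_n$$ for all discrete times $t_n=nh$, $n\in\mathbb N$.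
   Context: Let $m,d$ be positive integers, $(\Omega,\mathcal F,\mathbb P)$ a probability space with a normal filtration $(\mathcal F_t)_{t\ge0}$, and $W$ a standard $\mathbb R^d$-valued $(\mathcal F_t)$-Brownian motion with continuous paths. For a potential $V\colon\mathbb R^m\to\mathbb R$ with gradient $V'$, the separable Hamiltonian is $H(p,q)=\frac12\sum_{j=1}^m p_j^2+V(q)$ for $p,q\in\mathbb R^m$. The matrix $\Sigma\in\mathbb R^{m\times d}$ is constant. The scheme is a discretization of the stochastic Hamiltonian system $dq(t)=p(t)\,dt$, $dp(t)=-V'(q(t))\,dt+\Sigma\,dW(t)$, with initial values $(p_0,q_0)$ that are $\mathcal F_0$-measurable and have finite energy in expectation. The Wiener increments are $\Delta W_n=W(t_{n+1})-W(t_n)$ with $t_n=nh$; the integrals $\int_0^1\cdots ds$ are exact, and $(p_n,q_n)$ is $\mathcal F_{t_n}$-measurable.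
   Formalization: For each n the identity is stated when E[H(p_n,q_n)] is defined in [-∞,∞] (automatic for V bounded below); for general C^1 V it may be undefined, e.g. V(q)=-q²/2 with p_0=q_0 Cauchy. Finiteness of E[H(p_n,q_n)] is then proved. *)

theory Defs
  imports "HOL-Probability.Probability"
begin

text \<open>
  The usual conditions on a filtration indexed by times \<open>t \<ge> 0\<close>; the values \<open>F t\<close> for \<open>t < 0\<close>
  are irrelevant.
\<close>

definition normal_filtration :: "'a measure \<Rightarrow> (real \<Rightarrow> 'a measure) \<Rightarrow> bool" where
  "normal_filtration M F \<longleftrightarrow>
     (\<forall>t\<ge>0. subalgebra M (F t)) \<and>
     (\<forall>s\<ge>0. \<forall>t\<ge>s. sets (F s) \<subseteq> sets (F t)) \<and>
     null_sets M \<subseteq> sets (F 0) \<and>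
     (\<forall>t\<ge>0. sets (F t) = (\<Inter>u\<in>{t<..}. sets (F u)))"

text \<open>
  The increment \<open>W t - W s\<close> is independent of \<open>F s\<close> and is a centred Gaussian vector with covariance
  matrix \<open>t - s\<close> times the identity, i.e. its components are independent with law
  \<open>N(0, t - s)\<close>. The second parameter of \<^const>\<open>normal_density\<close> is the standard deviation.
\<close>

definition brownian_motion ::
    "'a measure \<Rightarrow> (real \<Rightarrow> 'a measure) \<Rightarrow> (real \<Rightarrow> 'a \<Rightarrow> real ^ 'd) \<Rightarrow> bool" where
  "brownian_motion M F W \<longleftrightarrow>
     (\<forall>t\<ge>0. W t \<in> borel_measurable (F t)) \<and>
     (AE \<omega> in M. W 0 \<omega> = 0) \<and>
     (\<forall>\<omega>\<in>space M. continuous_on {0..} (\<lambda>t. W t \<omega>)) \<and>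
     (\<forall>s\<ge>0. \<forall>t>s.
        prob_space.indep_set M (sets (F s))
          {(\<lambda>\<omega>. W t \<omega> - W s \<omega>) -` A \<inter> space M | A. A \<in> sets borel} \<and>
        prob_space.indep_vars M (\<lambda>_. borel) (\<lambda>i \<omega>. (W t \<omega> - W s \<omega>) $ i) UNIV \<and>
        (\<forall>i. distributed M lborel (\<lambda>\<omega>. (W t \<omega> - W s \<omega>) $ i)
               (normal_density 0 (sqrt (t - s)))))"

definition hamiltonian :: "(real ^ 'm \<Rightarrow> real) \<Rightarrow> real ^ 'm \<Rightarrow> real ^ 'm \<Rightarrow> real" where
  "hamiltonian V p q = (1 / 2) * (\<Sum>j\<in>UNIV. (p $ j)\<^sup>2) + V q"

text \<open>
  One step of the implicit drift-preserving scheme from \<open>(p, q)\<close> to \<open>(p', q')\<close>, where \<open>dV\<close> is the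
  gradient of the potential and \<open>w\<close> the Wiener increment. The existence of the stage \<open>\<Psi>\<close> is the
  solvability of the implicit equation for the data at hand.
\<close>

definition drift_preserving_step ::
    "(real ^ 'm \<Rightarrow> real ^ 'm) \<Rightarrow> real ^ 'd ^ 'm \<Rightarrow> real \<Rightarrow> real ^ 'd \<Rightarrow>
     real ^ 'm \<Rightarrow> real ^ 'm \<Rightarrow> real ^ 'm \<Rightarrow> real ^ 'm \<Rightarrow> bool" where
  "drift_preserving_step dV \<Sigma> h w p q p' q' \<longleftrightarrow>
     (\<exists>\<Psi>. \<Psi> = p + \<Sigma> *v w - (h / 2) *\<^sub>R integral {0..1} (\<lambda>s. dV (q + (s * h) *\<^sub>R \<Psi>)) \<and>
          q' = q + h *\<^sub>R \<Psi> \<and>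
          p' = p + \<Sigma> *v w - h *\<^sub>R integral {0..1} (\<lambda>s. dV (q + (s * h) *\<^sub>R \<Psi>)))"

text \<open>
  \<open>X\<close> has an expectation in \<open>[-\<infinity>, \<infinity>]\<close>: its positive part or its negative part has a finite
  integral (\<^const>\<open>ennreal\<close> truncates negative numbers to zero). Without this, the expectation of \<open>X\<close>
  is meaningless and the Bochner integral returns the junk value 0.
\<close>

definition has_expectation :: "'a measure \<Rightarrow> ('a \<Rightarrow> real) \<Rightarrow> bool" where
  "has_expectation M X \<longleftrightarrow>
     X \<in> borel_measurable M \<and>
     ((\<integral>\<^sup>+ \<omega>. ennreal (X \<omega>) \<partial>M) < \<infinity> \<or> (\<integral>\<^sup>+ \<omega>. ennreal (- X \<omega>) \<partial>M) < \<infinity>)"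

text \<open>In particular, for a potential bounded from below, the energy always has an expectation.\<close>

lemma has_expectation_hamiltonian:
  fixes V :: "real ^ 'm \<Rightarrow> real" and p q :: "'a \<Rightarrow> real ^ 'm"
  assumes "prob_space M"
    and V: "continuous_on UNIV V" "bdd_below (range V)"
    and [measurable]: "p \<in> borel_measurable M" "q \<in> borel_measurable M"
  shows "has_expectation M (\<lambda>\<omega>. hamiltonian V (p \<omega>) (q \<omega>))"
proof -
  interpret prob_space M by fact
  have [measurable]: "V \<in> borel_measurable borel"
    using V(1) by (rule borel_measurable_continuous_onI)
  have [measurable]: "(\<lambda>x. x $ j) \<in> borel_measurable borel" for j :: 'm
    by (intro borel_measurable_continuous_onI continuous_intros)
  have *: "(\<lambda>\<omega>. hamiltonian V (p \<omega>) (q \<omega>)) \<in> borel_measurable M"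
    unfolding hamiltonian_def by measurable
  obtain c where c: "\<And>x. c \<le> V x"
    using V(2) by (auto simp: bdd_below_def)
  have "- hamiltonian V (p \<omega>) (q \<omega>) \<le> \<bar>c\<bar>" for \<omega>
  proof -
    have "0 \<le> (\<Sum>j\<in>UNIV. (p \<omega> $ j)\<^sup>2)" by (simp add: sum_nonneg)
    then show ?thesis
      unfolding hamiltonian_def using c[of "q \<omega>"] by linarith
  qed
  then have "(\<integral>\<^sup>+ \<omega>. ennreal (- hamiltonian V (p \<omega>) (q \<omega>)) \<partial>M) \<le> (\<integral>\<^sup>+ \<omega>. ennreal \<bar>c\<bar> \<partial>M)"
    by (intro nn_integral_mono ennreal_leI) simp
  also have "\<dots> < \<infinity>" by (simp add: emeasure_space_1)
  finally show ?thesis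
    unfolding has_expectation_def using * by simp
qed

end

theory Submission
  imports Defs
begin

text \<open>
  Since \<open>\<Psi>\<close> is the mean of \<open>p\<^sub>n + \<Sigma> \<Delta>W\<^sub>n\<close> and \<open>p\<^sub>n\<^sub>+\<^sub>1\<close>, and the line integral of the gradient along
  the segment from \<open>q\<^sub>n\<close> to \<open>q\<^sub>n\<^sub>+\<^sub>1\<close> is exact, every step satisfies, path by path,
  \<open>H\<^sub>n\<^sub>+\<^sub>1 = H\<^sub>n + p\<^sub>n \<bullet> \<Sigma> \<Delta>W\<^sub>n + \<bar>\<Sigma> \<Delta>W\<^sub>n\<bar>\<^sup>2 / 2\<close>.
  The potential may be unbounded below, so \<open>p\<^sub>n\<close> need not be integrable and the compensated energy
  \<open>U\<^sub>n = H\<^sub>n - Tr(\<Sigma>\<^sup>T \<Sigma>) t\<^sub>n / 2\<close> is only a local martingale in discrete time. Such a process is a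
  martingale up to time \<open>n\<close> as soon as the positive or the negative part of \<open>U\<^sub>n\<close> is integrable:
  conditional Jensen on the sets of a localising sequence carries the integrability of the
  negative part back to time 0, and then the integrability of \<open>U\<^sub>k\<close> itself propagates forward.
\<close>

section \<open>Increments that are centred on a localising sequence\<close>

text \<open>
  Stands for a vanishing conditional expectation of \<open>D\<close> given \<open>G\<close> when \<open>D\<close> need not be integrable.
\<close>

definition locally_centred :: "'a measure \<Rightarrow> 'a measure \<Rightarrow> ('a \<Rightarrow> real) \<Rightarrow> bool" where
  "locally_centred M G D \<longleftrightarrow>
     (\<exists>A :: nat \<Rightarrow> 'a set. range A \<subseteq> sets G \<and> incseq A \<and> (\<Union>i. A i) = space M \<and>
        (\<forall>i. \<forall>B\<in>sets G. B \<subseteq> A i \<longrightarrow>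
           set_integrable M B D \<and> (LINT \<omega>:B|M. D \<omega>) = 0))"

lemma locally_centredE:
  assumes "locally_centred M G D"
  obtains A :: "nat \<Rightarrow> 'a set"
  where "\<And>i. A i \<in> sets G" "incseq A" "(\<Union>i. A i) = space M"
    and "\<And>i B. B \<in> sets G \<Longrightarrow> B \<subseteq> A i \<Longrightarrow> set_integrable M B D"
    and "\<And>i B. B \<in> sets G \<Longrightarrow> B \<subseteq> A i \<Longrightarrow> (LINT \<omega>:B|M. D \<omega>) = 0"
proof -
  obtain A :: "nat \<Rightarrow> 'a set"
    where "range A \<subseteq> sets G" "incseq A" "(\<Union>i. A i) = space M"
      "\<forall>i. \<forall>B\<in>sets G. B \<subseteq> A i \<longrightarrow> set_integrable M B D \<and> (LINT \<omega>:B|M. D \<omega>) = 0"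
    using assms unfolding locally_centred_def by (elim exE conjE)
  then show thesis by (intro that[of A]) auto
qed

lemma locally_centred_uminus:
  assumes "locally_centred M G D"
  shows "locally_centred M G (\<lambda>\<omega>. - D \<omega>)"
  using assms unfolding locally_centred_def set_integrable_def set_lebesgue_integral_def
  by simp

text \<open>The scheme holds only almost surely, so the energy increment is known only up to a null
  set. Integrals over sets of \<open>G\<close> do not see that change.\<close>

lemma locally_centred_cong_AE:
  assumes "locally_centred M G D" "subalgebra M G"
    and [measurable]: "D \<in> borel_measurable M" "D' \<in> borel_measurable M"
    and AE: "AE \<omega> in M. D' \<omega> = D \<omega>"
  shows "locally_centred M G D'"
proof -
  have "set_integrable M B D' = set_integrable M B D \<and> (LINT \<omega>:B|M. D' \<omega>) = (LINT \<omega>:B|M. D \<omega>)"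
    if "B \<in> sets G" for B
  proof -
    have [measurable]: "B \<in> sets M"
      using that \<open>subalgebra M G\<close> by (auto simp: subalgebra_def)
    show ?thesis
      unfolding set_integrable_def set_lebesgue_integral_def
      using AE by (intro conjI integrable_cong_AE integral_cong_AE) auto
  qed
  with assms(1) show ?thesis
    unfolding locally_centred_def by metis
qed

section \<open>Integrability and constant mean of a discrete-time local martingale\<close>

text \<open>Monotone convergence, in the form that removes a localisation: a bound uniform in
  \<open>i\<close> survives the passage to the whole space.\<close>

lemma nn_integral_le_of_incseq:
  assumes "incseq A" and sets [measurable]: "\<And>i. A i \<in> sets M" and UN: "(\<Union>i. A i) = space M"
    and [measurable]: "f \<in> borel_measurable M"
    and le: "\<And>i. (\<integral>\<^sup>+ \<omega>. f \<omega> * indicator (A i) \<omega> \<partial>M) \<le> K"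
  shows "(\<integral>\<^sup>+ \<omega>. f \<omega> \<partial>M) \<le> K"
proof -
  have "(\<integral>\<^sup>+ \<omega>. f \<omega> \<partial>M) = (\<integral>\<^sup>+ \<omega>. (SUP i. f \<omega> * indicator (A i) \<omega>) \<partial>M)"
  proof (rule nn_integral_cong)
    fix \<omega> assume "\<omega> \<in> space M"
    then obtain i where i: "\<omega> \<in> A i" using UN by auto
    show "f \<omega> = (SUP i. f \<omega> * indicator (A i) \<omega>)"
    proof (rule antisym)
      show "f \<omega> \<le> (SUP i. f \<omega> * indicator (A i) \<omega>)"
        by (rule SUP_upper2[of i]) (use i in auto)
      show "(SUP i. f \<omega> * indicator (A i) \<omega>) \<le> f \<omega>"
        by (rule SUP_least) (auto simp: indicator_def)
    qed
  qed
  also have "\<dots> = (SUP i. \<integral>\<^sup>+ \<omega>. f \<omega> * indicator (A i) \<omega> \<partial>M)"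
    using \<open>incseq A\<close> by (intro nn_integral_monotone_convergence_SUP)
      (auto simp: incseq_def le_fun_def indicator_def)
  also have "\<dots> \<le> K" by (intro SUP_least le)
  finally show ?thesis .
qed

lemma ennreal_integral_le_nn_integral:
  fixes f :: "'a \<Rightarrow> real"
  assumes "integrable M f"
  shows "ennreal (integral\<^sup>L M f) \<le> (\<integral>\<^sup>+ \<omega>. ennreal (f \<omega>) \<partial>M)"
proof -
  have "ennreal (integral\<^sup>L M f) \<le> ennreal (\<integral>\<omega>. max 0 (f \<omega>) \<partial>M)"
    using assms by (intro ennreal_leI integral_mono) auto
  also have "\<dots> = (\<integral>\<^sup>+ \<omega>. ennreal (max 0 (f \<omega>)) \<partial>M)"
    using assms by (intro nn_integral_eq_integral[symmetric]) auto
  finally show ?thesis by (simp add: ennreal_max_0)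
qed

text \<open>Conditional Jensen for the negative part, without assuming \<open>Y\<close> or
  \<open>Y'\<close> integrable. The event \<open>Y < 0\<close> lies in \<open>G\<close>, so on
  localised pieces of it \<open>Y\<close> and \<open>Y'\<close> have the same integral; there
  \<open>- Y\<close> is its own negative part, while \<open>- Y'\<close> is at most its negative
  part.\<close>

lemma nn_integral_negative_part_le:
  assumes "prob_space M" and sub: "subalgebra M G" and [measurable]: "Y \<in> borel_measurable G"
    and [measurable]: "Y' \<in> borel_measurable M"
    and D: "locally_centred M G (\<lambda>\<omega>. Y' \<omega> - Y \<omega>)"
  shows "(\<integral>\<^sup>+ \<omega>. ennreal (- Y \<omega>) \<partial>M) \<le> (\<integral>\<^sup>+ \<omega>. ennreal (- Y' \<omega>) \<partial>M)"
proof -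
  interpret prob_space M by fact
  have space: "space G = space M" and sets: "\<And>B. B \<in> sets G \<Longrightarrow> B \<in> sets M"
    using sub by (auto simp: subalgebra_def)
  obtain A :: "nat \<Rightarrow> 'a set" where A: "\<And>i. A i \<in> sets G" "incseq A" "(\<Union>i. A i) = space M"
    and centred: "\<And>i B. B \<in> sets G \<Longrightarrow> B \<subseteq> A i \<Longrightarrow>
      set_integrable M B (\<lambda>\<omega>. Y' \<omega> - Y \<omega>)"
      "\<And>i B. B \<in> sets G \<Longrightarrow> B \<subseteq> A i \<Longrightarrow> (LINT \<omega>:B|M. Y' \<omega> - Y \<omega>) = 0"
    by (rule locally_centredE[OF D]) (rule that)
  have [measurable]: "Y \<in> borel_measurable M"
    by (rule measurable_from_subalg[OF sub]) fact
  \<comment> \<open>The extra cut at level \<open>i\<close> makes \<open>Y\<close> bounded, hence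
    integrable, on each piece. It stays in \<open>G\<close> since \<open>Y\<close> is
    \<open>G\<close>-measurable.\<close>
  define E where "E i = A i \<inter> {\<omega> \<in> space M. \<bar>Y \<omega>\<bar> \<le> real i}" for i
  have E: "E i \<in> sets G" for i
    unfolding E_def space[symmetric] using A(1)[of i] by measurable
  show ?thesis
  proof (rule nn_integral_le_of_incseq[of E])
    show "incseq E"
      using \<open>incseq A\<close> unfolding E_def incseq_def by fastforce
    show "E i \<in> sets M" for i by (intro sets E)
    show "(\<Union>i. E i) = space M"
    proof (intro equalityI subsetI)
      fix \<omega> assume \<omega>: "\<omega> \<in> space M"
      then obtain i where i: "\<omega> \<in> A i" using A(3) by auto
      obtain j where j: "\<bar>Y \<omega>\<bar> \<le> real j" using real_arch_simple by blast
      have "\<omega> \<in> A (max i j)" using i incseqD[OF \<open>incseq A\<close>, of i "max i j"] by auto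
      then show "\<omega> \<in> (\<Union>i. E i)"
        using \<omega> j by (auto simp: E_def intro!: exI[of _ "max i j"])
    qed (auto simp: E_def)
    show "(\<lambda>\<omega>. ennreal (- Y \<omega>)) \<in> borel_measurable M" by measurable
  next
    fix i
    define C where "C = E i \<inter> {\<omega> \<in> space G. Y \<omega> < 0}"
    have C: "C \<in> sets G" "C \<subseteq> A i"
      unfolding C_def using E[of i] by (measurable, auto simp: E_def)
    have [measurable]: "C \<in> sets M" by (intro sets C)
    have Y: "integrable M (\<lambda>\<omega>. indicator C \<omega> * Y \<omega>)"
    proof (rule integrable_const_bound)
      show "AE \<omega> in M. norm (indicator C \<omega> * Y \<omega>) \<le> real i"
        by (auto simp: C_def E_def indicator_def)
    qed measurable
    have D: "integrable M (\<lambda>\<omega>. indicator C \<omega> * (Y' \<omega> - Y \<omega>))"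
      "(\<integral>\<omega>. indicator C \<omega> * (Y' \<omega> - Y \<omega>) \<partial>M) = 0"
      using centred[OF C] by (auto simp: set_integrable_def set_lebesgue_integral_def)
    \<comment> \<open>\<open>Y'\<close> is reached only through this splitting: its integrability on
      \<open>C\<close> comes from that of \<open>Y\<close> and of the centred difference.\<close>
    have eq: "indicator C \<omega> * Y' \<omega> = indicator C \<omega> * Y \<omega> + indicator C \<omega> * (Y' \<omega> - Y \<omega>)" for \<omega>
      by (simp add: algebra_simps)
    have Y': "integrable M (\<lambda>\<omega>. indicator C \<omega> * Y' \<omega>)"
      "(\<integral>\<omega>. indicator C \<omega> * Y' \<omega> \<partial>M) = (\<integral>\<omega>. indicator C \<omega> * Y \<omega> \<partial>M)"
      unfolding eq using Y D by auto
    have "(\<integral>\<^sup>+ \<omega>. ennreal (- Y \<omega>) * indicator (E i) \<omega> \<partial>M)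
        = (\<integral>\<^sup>+ \<omega>. ennreal (- (indicator C \<omega> * Y \<omega>)) \<partial>M)"
      by (intro nn_integral_cong) (auto simp: C_def space indicator_def ennreal_neg)
    also have "\<dots> = ennreal (\<integral>\<omega>. - (indicator C \<omega> * Y \<omega>) \<partial>M)"
      using Y by (intro nn_integral_eq_integral) (auto simp: C_def indicator_def)
    also have "\<dots> = ennreal (\<integral>\<omega>. - (indicator C \<omega> * Y' \<omega>) \<partial>M)"
      using Y'(2) by simp
    also have "\<dots> \<le> (\<integral>\<^sup>+ \<omega>. ennreal (- (indicator C \<omega> * Y' \<omega>)) \<partial>M)"
      using Y'(1) by (intro ennreal_integral_le_nn_integral) auto
    also have "\<dots> \<le> (\<integral>\<^sup>+ \<omega>. ennreal (- Y' \<omega>) \<partial>M)"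
      by (intro nn_integral_mono) (auto simp: indicator_def)
    finally show "(\<integral>\<^sup>+ \<omega>. ennreal (- Y \<omega>) * indicator (E i) \<omega> \<partial>M)
        \<le> (\<integral>\<^sup>+ \<omega>. ennreal (- Y' \<omega>) \<partial>M)" .
  qed
qed

text \<open>On each localising set \<open>Y'\<close> and \<open>Y\<close> have the same integral.
  Adding the integrable negative part of \<open>Y'\<close> bounds its positive part there, uniformly
  in \<open>i\<close>, so \<open>Y'\<close> is integrable and the localisation can be removed from
  both integrals.\<close>

lemma integrable_of_locally_centred:
  assumes sub: "subalgebra M G" and Y: "integrable M Y"
    and meas [measurable]: "Y' \<in> borel_measurable M"
    and D: "locally_centred M G (\<lambda>\<omega>. Y' \<omega> - Y \<omega>)"
    and neg: "(\<integral>\<^sup>+ \<omega>. ennreal (- Y' \<omega>) \<partial>M) < \<infinity>"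
  shows "integrable M Y'" and "integral\<^sup>L M Y' = integral\<^sup>L M Y"
proof -
  obtain A :: "nat \<Rightarrow> 'a set" where A: "\<And>i. A i \<in> sets G" "incseq A" "(\<Union>i. A i) = space M"
    and "*": "\<And>i B. B \<in> sets G \<Longrightarrow> B \<subseteq> A i \<Longrightarrow>
      set_integrable M B (\<lambda>\<omega>. Y' \<omega> - Y \<omega>)"
      "\<And>i B. B \<in> sets G \<Longrightarrow> B \<subseteq> A i \<Longrightarrow> (LINT \<omega>:B|M. Y' \<omega> - Y \<omega>) = 0"
    by (rule locally_centredE[OF D]) (rule that)
  note centred = *(1)[OF A(1) order_refl] *(2)[OF A(1) order_refl]
  have AM [measurable]: "A i \<in> sets M" for i
    using A(1)[of i] sub by (auto simp: subalgebra_def)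
  have YA: "integrable M (\<lambda>\<omega>. indicator (A i) \<omega> * Y \<omega>)" for i
    using integrable_mult_indicator[OF AM[of i] Y] by simp
  have eq: "indicator (A i) \<omega> * Y' \<omega> = indicator (A i) \<omega> * Y \<omega> + indicator (A i) \<omega> * (Y' \<omega> - Y \<omega>)"
    for \<omega> i by (simp add: algebra_simps)
  have Y'A: "integrable M (\<lambda>\<omega>. indicator (A i) \<omega> * Y' \<omega>)"
    "(\<integral>\<omega>. indicator (A i) \<omega> * Y' \<omega> \<partial>M) = (\<integral>\<omega>. indicator (A i) \<omega> * Y \<omega> \<partial>M)" for i
    unfolding eq using YA[of i] centred[of i]
    by (auto simp: set_integrable_def set_lebesgue_integral_def)
  define N where "N \<omega> = max 0 (- Y' \<omega>)" for \<omega>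
  have N: "integrable M N"
    unfolding N_def using neg by (intro integrableI_bounded) (auto simp: ennreal_max_0)
  have NA: "integrable M (\<lambda>\<omega>. indicator (A i) \<omega> * N \<omega>)" for i
    using integrable_mult_indicator[OF AM[of i] N] by simp
  \<comment> \<open>The positive part of \<open>Y'\<close> is \<open>Y' + N\<close>. On
    \<open>A i\<close> the integral of \<open>Y'\<close> may be replaced by that of
    \<open>Y\<close>, which gives a constant independent of \<open>i\<close>.\<close>
  have "(\<integral>\<^sup>+ \<omega>. ennreal (Y' \<omega>) \<partial>M) \<le> ennreal ((\<integral>\<omega>. \<bar>Y \<omega>\<bar> \<partial>M) + (\<integral>\<omega>. N \<omega> \<partial>M))"
  proof (rule nn_integral_le_of_incseq[of A])
    fix i
    have "(\<integral>\<^sup>+ \<omega>. ennreal (Y' \<omega>) * indicator (A i) \<omega> \<partial>M)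
        = (\<integral>\<^sup>+ \<omega>. ennreal (indicator (A i) \<omega> * Y' \<omega> + indicator (A i) \<omega> * N \<omega>) \<partial>M)"
      by (intro nn_integral_cong) (auto simp: N_def indicator_def max_def ennreal_neg)
    also have "\<dots> = ennreal (\<integral>\<omega>. indicator (A i) \<omega> * Y' \<omega> + indicator (A i) \<omega> * N \<omega> \<partial>M)"
      using Y'A NA by (intro nn_integral_eq_integral) (auto simp: N_def indicator_def max_def)
    also have "\<dots> = ennreal ((\<integral>\<omega>. indicator (A i) \<omega> * Y \<omega> \<partial>M) + (\<integral>\<omega>. indicator (A i) \<omega> * N \<omega> \<partial>M))"
      using Y'A NA by simp
    also have "\<dots> \<le> ennreal ((\<integral>\<omega>. \<bar>Y \<omega>\<bar> \<partial>M) + (\<integral>\<omega>. N \<omega> \<partial>M))"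
      by (intro ennreal_leI add_mono integral_mono YA NA N integrable_abs[OF Y])
        (auto simp: N_def indicator_def)
    finally show "(\<integral>\<^sup>+ \<omega>. ennreal (Y' \<omega>) * indicator (A i) \<omega> \<partial>M) \<le> \<dots>" .
  qed (use A in auto)
  then have "(\<integral>\<^sup>+ \<omega>. ennreal (Y' \<omega>) \<partial>M) < \<infinity>"
    by (simp add: order_le_less_trans)
  with neg show Y': "integrable M Y'"
    by (simp add: real_integrable_def less_top)
  \<comment> \<open>The set integrals of \<open>Y\<close> and \<open>Y'\<close> over
    \<open>A i\<close> form one and the same sequence, so their limits, the two full integrals,
    agree.\<close>
  have "(\<lambda>i. LINT \<omega>:A i|M. f \<omega>) \<longlonglongrightarrow> integral\<^sup>L M f" if "integrable M f" for f :: "'a \<Rightarrow> real"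
    using set_integral_cont_up[of A M f] A that integrable_mult_indicator[OF sets.top that]
    by (simp add: set_integrable_def set_integral_space)
  from this[OF Y] this[OF Y'] show "integral\<^sup>L M Y' = integral\<^sup>L M Y"
    using Y'A(2) by (simp add: set_lebesgue_integral_def LIMSEQ_unique)
qed

text \<open>The induction runs both ways in time: the one-sided bound at \<open>Suc n\<close> is
  first pulled back to \<open>n\<close>, where the induction hypothesis yields integrability of
  \<open>U n\<close>, and this is then pushed forward to \<open>Suc n\<close>. Hence a bound at the
  final time alone suffices.\<close>

lemma integral_local_martingale_eq_initial:
  assumes "prob_space M" "\<And>k. subalgebra M (G k)" "\<And>k. U k \<in> borel_measurable (G k)"
    and "\<And>k. locally_centred M (G k) (\<lambda>\<omega>. U (Suc k) \<omega> - U k \<omega>)"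
    and "integrable M (U 0)" and "(\<integral>\<^sup>+ \<omega>. ennreal (- U n \<omega>) \<partial>M) < \<infinity>"
  shows "integrable M (U n) \<and> integral\<^sup>L M (U n) = integral\<^sup>L M (U 0)"
  using assms(6)
proof (induction n)
  case 0
  then show ?case using assms(5) by simp
next
  case (Suc n)
  have [measurable]: "U k \<in> borel_measurable M" for k
    using assms(2,3) by (rule measurable_from_subalg)
  have "(\<integral>\<^sup>+ \<omega>. ennreal (- U n \<omega>) \<partial>M) < \<infinity>"
    using nn_integral_negative_part_le[OF assms(1) assms(2)[of n] assms(3)[of n], of "U (Suc n)"]
      assms(4)[of n] Suc.prems by (auto intro: order_le_less_trans)
  then have "integrable M (U n)" "integral\<^sup>L M (U n) = integral\<^sup>L M (U 0)"
    using Suc.IH by auto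
  then show ?case
    using integrable_of_locally_centred[OF assms(2)[of n], of "U n" "U (Suc n)"]
      assms(4)[of n] Suc.prems by auto
qed

section \<open>Moments and centring of the noise terms\<close>

text \<open>Boundedness makes \<open>b\<close> integrable, and independence of \<open>w\<close> from
  \<open>G\<close> then factorises the expectation, with a zero factor from
  \<open>f (w \<omega>)\<close>.\<close>

lemma (in prob_space) expectation_bounded_mult_indep:
  fixes b \<xi> :: "'a \<Rightarrow> real"
  assumes indep: "indep_set (sets G) {w -` A \<inter> space M | A. A \<in> sets N}"
    and sub: "subalgebra M G" and b: "b \<in> borel_measurable G" "\<And>\<omega>. \<omega> \<in> space M \<Longrightarrow> \<bar>b \<omega>\<bar> \<le> K"
    and w: "w \<in> measurable M N" and f: "f \<in> borel_measurable N"
    and int: "integrable M (\<lambda>\<omega>. f (w \<omega>))" and zero: "expectation (\<lambda>\<omega>. f (w \<omega>)) = 0"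
  shows "integrable M (\<lambda>\<omega>. b \<omega> * f (w \<omega>))" and "expectation (\<lambda>\<omega>. b \<omega> * f (w \<omega>)) = 0"
proof -
  have bM: "b \<in> borel_measurable M"
    using sub b(1) by (rule measurable_from_subalg)
  have bint: "integrable M b"
    using b(2) bM by (intro integrable_const_bound[of _ K]) auto
  have fM: "(\<lambda>\<omega>. f (w \<omega>)) \<in> borel_measurable M"
    using w f by (rule measurable_compose)
  have "indep_var borel b borel (\<lambda>\<omega>. f (w \<omega>))"
    unfolding indep_var_eq
  proof (intro conjI bM fM)
    have "sigma_sets (space M) {b -` A \<inter> space M | A. A \<in> sets borel} \<subseteq> sets G"
    proof -
      have "{b -` A \<inter> space M | A. A \<in> sets borel} \<subseteq> sets G"
        using b(1) sub by (auto simp: subalgebra_def dest: measurable_sets)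
      then show ?thesis
        using sets.sigma_sets_subset[of _ G] sub by (simp add: subalgebra_def)
    qed
    \<comment> \<open>The preimages under \<open>w\<close> already form a sigma-algebra, namely
      \<open>vimage_algebra (space M) w N\<close>, so checking the generators is enough.\<close>
    moreover have "sigma_sets (space M) {(\<lambda>\<omega>. f (w \<omega>)) -` A \<inter> space M | A. A \<in> sets borel}
        \<subseteq> {w -` A \<inter> space M | A. A \<in> sets N}"
    proof -
      have "{(\<lambda>\<omega>. f (w \<omega>)) -` A \<inter> space M | A. A \<in> sets borel} \<subseteq> sets (vimage_algebra (space M) w N)"
      proof safe
        fix A :: "real set" assume "A \<in> sets borel"
        with f have "f -` A \<inter> space N \<in> sets N" by (rule measurable_sets)
        moreover have "(\<lambda>\<omega>. f (w \<omega>)) -` A \<inter> space M = w -` (f -` A \<inter> space N) \<inter> space M"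
          using w by (auto dest: measurable_space)
        ultimately show "(\<lambda>\<omega>. f (w \<omega>)) -` A \<inter> space M \<in> sets (vimage_algebra (space M) w N)"
          by (simp only: in_vimage_algebra)
      qed
      from sets.sigma_sets_subset[OF this] show ?thesis
        using w by (simp add: sets_vimage_algebra2 measurable_def)
    qed
    ultimately show "indep_set (sigma_sets (space M) {b -` A \<inter> space M | A. A \<in> sets borel})
        (sigma_sets (space M) {(\<lambda>\<omega>. f (w \<omega>)) -` A \<inter> space M | A. A \<in> sets borel})"
      using indep unfolding indep_set_def
      by (elim indep_sets_mono_sets) (auto split: bool.split)
  qed
  note * = indep_var_integrable[OF this bint int] indep_var_lebesgue_integral[OF this bint int]
  show "integrable M (\<lambda>\<omega>. b \<omega> * f (w \<omega>))" and "expectation (\<lambda>\<omega>. b \<omega> * f (w \<omega>)) = 0"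
    using * zero by simp_all
qed

text \<open>\<open>P\<close> need not be integrable. The sets where its norm is at most
  \<open>i\<close> belong to \<open>G\<close> and exhaust the space; inside them every component of
  \<open>P\<close> is a bounded factor independent of \<open>w\<close>.\<close>

lemma (in prob_space) locally_centred_linear_combination:
  fixes P w :: "'a \<Rightarrow> real ^ 'd"
  assumes indep: "indep_set (sets G) {w -` A \<inter> space M | A. A \<in> sets borel}"
    and sub: "subalgebra M G" and P [measurable]: "P \<in> borel_measurable G"
    and w: "w \<in> borel_measurable M" and f: "f \<in> borel_measurable borel"
    and w_int: "\<And>i. integrable M (\<lambda>\<omega>. w \<omega> $ i)" "\<And>i. expectation (\<lambda>\<omega>. w \<omega> $ i) = 0"
    and f_int: "integrable M (\<lambda>\<omega>. f (w \<omega>))" "expectation (\<lambda>\<omega>. f (w \<omega>)) = 0"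
  shows "locally_centred M G (\<lambda>\<omega>. P \<omega> \<bullet> w \<omega> + f (w \<omega>))"
proof -
  have space: "space G = space M"
    using sub by (simp add: subalgebra_def)
  have nth [measurable]: "(\<lambda>x. x $ i) \<in> borel_measurable borel" for i :: 'd
    by (intro borel_measurable_continuous_onI continuous_intros)
  define A where "A i = {\<omega> \<in> space G. norm (P \<omega>) \<le> real i}" for i :: nat
  have "set_integrable M B (\<lambda>\<omega>. P \<omega> \<bullet> w \<omega> + f (w \<omega>)) \<and> (LINT \<omega>:B|M. P \<omega> \<bullet> w \<omega> + f (w \<omega>)) = 0"
    if [measurable]: "B \<in> sets G" and B: "B \<subseteq> A i" for B i
  proof -
    have eq: "indicator B \<omega> *\<^sub>R (P \<omega> \<bullet> w \<omega> + f (w \<omega>)) =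
        (\<Sum>j\<in>UNIV. (indicator B \<omega> * P \<omega> $ j) * w \<omega> $ j) + indicator B \<omega> * f (w \<omega>)" for \<omega>
      by (simp add: inner_vec_def sum_distrib_left algebra_simps)
    have 1: "integrable M (\<lambda>\<omega>. (indicator B \<omega> * P \<omega> $ j) * w \<omega> $ j)"
      "expectation (\<lambda>\<omega>. (indicator B \<omega> * P \<omega> $ j) * w \<omega> $ j) = 0" for j
    proof -
      have "(\<lambda>\<omega>. indicator B \<omega> * P \<omega> $ j) \<in> borel_measurable G" by measurable
      moreover have "\<bar>indicator B \<omega> * P \<omega> $ j\<bar> \<le> real i" for \<omega>
        using B component_le_norm_cart[of "P \<omega>" j]
        by (auto simp: A_def indicator_def intro: order_trans)
      ultimately show "integrable M (\<lambda>\<omega>. (indicator B \<omega> * P \<omega> $ j) * w \<omega> $ j)"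
        "expectation (\<lambda>\<omega>. (indicator B \<omega> * P \<omega> $ j) * w \<omega> $ j) = 0"
        using expectation_bounded_mult_indep[OF indep sub _ _ w nth w_int] by blast+
    qed
    have 2: "integrable M (\<lambda>\<omega>. indicator B \<omega> * f (w \<omega>))"
      "expectation (\<lambda>\<omega>. indicator B \<omega> * f (w \<omega>)) = 0"
      using expectation_bounded_mult_indep[OF indep sub _ _ w f f_int, of "indicator B" 1]
      by (auto simp del: indicator_simps)
    show ?thesis
      unfolding set_integrable_def set_lebesgue_integral_def eq
      using 1 2 by (simp add: integral_sum)
  qed
  moreover have "range A \<subseteq> sets G" unfolding A_def by auto
  moreover have "incseq A" unfolding A_def incseq_def by fastforce
  moreover have "(\<Union>i. A i) = space M"
    unfolding A_def space using real_arch_simple by blast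
  ultimately show ?thesis unfolding locally_centred_def by blast
qed

text \<open>Expanding the square leaves second moments of the components of \<open>w\<close>.
  Independence and centring kill the mixed ones, and the diagonal ones add up to \<open>v\<close>
  times the sum of the squared entries of \<open>\<Sigma>\<close>.\<close>

lemma (in prob_space) expectation_power2_norm_matrix:
  fixes \<Sigma> :: "real ^ 'd ^ 'm" and w :: "'a \<Rightarrow> real ^ 'd"
  assumes indep: "indep_vars (\<lambda>_. borel) (\<lambda>i \<omega>. w \<omega> $ i) UNIV"
    and int: "\<And>i. integrable M (\<lambda>\<omega>. w \<omega> $ i)" "\<And>i. expectation (\<lambda>\<omega>. w \<omega> $ i) = 0"
    and int2: "\<And>i. integrable M (\<lambda>\<omega>. (w \<omega> $ i)\<^sup>2)" "\<And>i. expectation (\<lambda>\<omega>. (w \<omega> $ i)\<^sup>2) = v"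
  shows "integrable M (\<lambda>\<omega>. (norm (\<Sigma> *v w \<omega>))\<^sup>2)"
    and "expectation (\<lambda>\<omega>. (norm (\<Sigma> *v w \<omega>))\<^sup>2) = trace (transpose \<Sigma> ** \<Sigma>) * v"
proof -
  have prod: "integrable M (\<lambda>\<omega>. w \<omega> $ i * w \<omega> $ k) \<and>
      expectation (\<lambda>\<omega>. w \<omega> $ i * w \<omega> $ k) = (if i = k then v else 0)" for i k
  proof (cases "i = k")
    case True
    then show ?thesis using int2[of k] by (simp add: power2_eq_square)
  next
    case False
    have "indep_vars (\<lambda>_. borel) (\<lambda>i \<omega>. w \<omega> $ i) {i, k}"
      using indep by (rule indep_vars_subset) simp
    from indep_vars_integrable[OF _ this] indep_vars_lebesgue_integral[OF _ this]
    show ?thesis using False int by simp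
  qed
  have eq: "(norm (\<Sigma> *v w \<omega>))\<^sup>2 =
      (\<Sum>j\<in>UNIV. \<Sum>i\<in>UNIV. \<Sum>k\<in>UNIV. \<Sigma> $ j $ i * \<Sigma> $ j $ k * (w \<omega> $ i * w \<omega> $ k))" for \<omega>
    by (simp add: power2_norm_eq_inner inner_vec_def matrix_vector_mult_def sum_product algebra_simps)
  show "integrable M (\<lambda>\<omega>. (norm (\<Sigma> *v w \<omega>))\<^sup>2)"
    unfolding eq using prod by auto
  have "expectation (\<lambda>\<omega>. (norm (\<Sigma> *v w \<omega>))\<^sup>2) =
      (\<Sum>j\<in>UNIV. \<Sum>i\<in>UNIV. \<Sum>k\<in>UNIV. \<Sigma> $ j $ i * \<Sigma> $ j $ k * (if i = k then v else 0))"
    unfolding eq using prod by (simp add: integral_sum)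
  also have "\<dots> = (\<Sum>j\<in>UNIV. \<Sum>i\<in>UNIV. \<Sigma> $ j $ i * \<Sigma> $ j $ i * v)"
    by (simp add: if_distrib cong: if_cong)
  also have "\<dots> = trace (transpose \<Sigma> ** \<Sigma>) * v"
    by (subst sum.swap) (simp add: trace_def matrix_matrix_mult_def transpose_def sum_distrib_right)
  finally show "expectation (\<lambda>\<omega>. (norm (\<Sigma> *v w \<omega>))\<^sup>2) = trace (transpose \<Sigma> ** \<Sigma>) * v" .
qed

lemma (in prob_space) normal_distributed_second_moment:
  assumes "0 < \<sigma>" and D: "distributed M lborel X (normal_density 0 \<sigma>)"
  shows "integrable M X" and "integrable M (\<lambda>\<omega>. (X \<omega>)\<^sup>2)"
    and "expectation (\<lambda>\<omega>. (X \<omega>)\<^sup>2) = \<sigma>\<^sup>2"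
proof -
  show "integrable M X"
    using distributed_integrable[OF D, of "\<lambda>x. x"] integrable_normal_moment[OF assms(1), of 0 1]
    by simp
  show "integrable M (\<lambda>\<omega>. (X \<omega>)\<^sup>2)"
    using distributed_integrable[OF D, of "\<lambda>x. x\<^sup>2"] integrable_normal_moment[OF assms(1), of 0 2]
    by simp
  show "expectation (\<lambda>\<omega>. (X \<omega>)\<^sup>2) = \<sigma>\<^sup>2"
    using normal_distributed_variance[OF assms] normal_distributed_expectation[OF assms] by simp
qed

section \<open>Pathwise energy balance of one step\<close>

text \<open>Chain rule along the segment and the fundamental theorem of calculus. Continuity of
  \<open>dV\<close> makes the vector-valued integral exist, so that the inner product with
  \<open>v\<close> can be moved inside.\<close>

lemma integral_gradient_segment:
  fixes V :: "'v::euclidean_space \<Rightarrow> real"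
  assumes grad: "\<And>x. GDERIV V x :> dV x" and cont: "continuous_on UNIV dV"
  shows "v \<bullet> integral {0..1} (\<lambda>s. dV (x + s *\<^sub>R v)) = V (x + v) - V x"
proof -
  have "((\<lambda>s. V (x + s *\<^sub>R v)) has_vector_derivative v \<bullet> dV (x + s *\<^sub>R v)) (at s within {0..1})" for s
  proof -
    have "((\<lambda>s. x + s *\<^sub>R v) has_derivative (\<lambda>t. t *\<^sub>R v)) (at s within {0..1})"
      by (auto intro!: derivative_eq_intros)
    from has_derivative_compose[OF this grad[unfolded gderiv_def]] show ?thesis
      by (simp add: has_vector_derivative_def)
  qed
  then have "((\<lambda>s. v \<bullet> dV (x + s *\<^sub>R v)) has_integral V (x + 1 *\<^sub>R v) - V (x + 0 *\<^sub>R v)) {0..1}"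
    by (intro fundamental_theorem_of_calculus) auto
  moreover have "(\<lambda>s. dV (x + s *\<^sub>R v)) integrable_on {0..1}"
    by (intro integrable_continuous_real continuous_on_compose2[OF cont] continuous_intros) auto
  from has_integral_linear[OF integrable_integral[OF this] bounded_linear_inner_right[of v]]
  have "((\<lambda>s. v \<bullet> dV (x + s *\<^sub>R v)) has_integral v \<bullet> integral {0..1} (\<lambda>s. dV (x + s *\<^sub>R v))) {0..1}"
    by (simp add: o_def)
  ultimately show ?thesis
    by (auto dest: has_integral_unique)
qed

text \<open>With \<open>a = p + \<Sigma> *v w\<close>, the stage \<open>\<Psi>\<close> is the
  midpoint of \<open>a\<close> and \<open>p'\<close>, so the kinetic change from \<open>a\<close> to
  \<open>p'\<close> is \<open>(p' - a) \<bullet> \<Psi> = - h * (\<Psi> \<bullet> I)\<close>. This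
  cancels the potential change exactly, and only the kinetic change from \<open>p\<close> to
  \<open>a\<close> remains. The form \<open>p v* \<Sigma>\<close> isolates \<open>w\<close> as the
  second factor.\<close>

lemma drift_preserving_step_hamiltonian:
  assumes grad: "\<And>x. GDERIV V x :> dV x" and cont: "continuous_on UNIV dV"
    and step: "drift_preserving_step dV \<Sigma> h w p q p' q'"
  shows "hamiltonian V p' q' - hamiltonian V p q =
    (p v* \<Sigma>) \<bullet> w + (norm (\<Sigma> *v w))\<^sup>2 / 2"
proof -
  obtain \<Psi> where \<Psi>: "\<Psi> = p + \<Sigma> *v w - (h / 2) *\<^sub>R integral {0..1} (\<lambda>s. dV (q + (s * h) *\<^sub>R \<Psi>))"
    and q': "q' = q + h *\<^sub>R \<Psi>"
    and p': "p' = p + \<Sigma> *v w - h *\<^sub>R integral {0..1} (\<lambda>s. dV (q + (s * h) *\<^sub>R \<Psi>))"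
    using step unfolding drift_preserving_step_def by blast
  define I where "I = integral {0..1} (\<lambda>s. dV (q + (s * h) *\<^sub>R \<Psi>))"
  define a where "a = p + \<Sigma> *v w"
  have V: "V q' - V q = h * (\<Psi> \<bullet> I)"
    using integral_gradient_segment[OF grad cont, of "h *\<^sub>R \<Psi>" q] by (simp add: I_def q')
  have H: "hamiltonian V x y = (x \<bullet> x) / 2 + V y" for x y
    by (simp add: hamiltonian_def inner_vec_def power2_eq_square)
  have "\<Psi> = a - (h / 2) *\<^sub>R I" and "p' = a - h *\<^sub>R I"
    using \<Psi> p' unfolding I_def a_def by auto
  then have "h * (\<Psi> \<bullet> I) + (p' \<bullet> p') / 2 = (a \<bullet> a) / 2"
    by (simp only:) (simp add: inner_diff_left inner_diff_right inner_commute field_simps)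
  then have "hamiltonian V p' q' - hamiltonian V p q = (a \<bullet> a) / 2 - (p \<bullet> p) / 2"
    using V by (simp add: H)
  also have "\<dots> = p \<bullet> (\<Sigma> *v w) + (norm (\<Sigma> *v w))\<^sup>2 / 2"
    by (simp add: a_def power2_norm_eq_inner inner_add_left inner_add_right inner_commute field_simps)
  finally show ?thesis by (simp add: dot_lmul_matrix)
qed

section \<open>Linear growth of the expected energy\<close>

theorem theorem3:
  fixes M :: "'a measure" and F :: "real \<Rightarrow> 'a measure"
    and W :: "real \<Rightarrow> 'a \<Rightarrow> real ^ 'd"
    and V :: "real ^ 'm \<Rightarrow> real" and dV :: "real ^ 'm \<Rightarrow> real ^ 'm"
    and \<Sigma> :: "real ^ 'd ^ 'm" and h :: real
    and p q :: "nat \<Rightarrow> 'a \<Rightarrow> real ^ 'm"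
  assumes "prob_space M"
    and "normal_filtration M F"
    and "brownian_motion M F W"
    and "\<And>x. GDERIV V x :> dV x"
    and "continuous_on UNIV dV"
    and "h > 0"
    and "\<And>k. p k \<in> borel_measurable (F (real k * h))"
    and "\<And>k. q k \<in> borel_measurable (F (real k * h))"
    and "\<And>k. AE \<omega> in M. drift_preserving_step dV \<Sigma> h
           (W (real (Suc k) * h) \<omega> - W (real k * h) \<omega>)
           (p k \<omega>) (q k \<omega>) (p (Suc k) \<omega>) (q (Suc k) \<omega>)"
    and "integrable M (\<lambda>\<omega>. hamiltonian V (p 0 \<omega>) (q 0 \<omega>))"
  shows "\<forall>n. has_expectation M (\<lambda>\<omega>. hamiltonian V (p n \<omega>) (q n \<omega>)) \<longrightarrow>
           integrable M (\<lambda>\<omega>. hamiltonian V (p n \<omega>) (q n \<omega>)) \<and>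
           prob_space.expectation M (\<lambda>\<omega>. hamiltonian V (p n \<omega>) (q n \<omega>)) =
             prob_space.expectation M (\<lambda>\<omega>. hamiltonian V (p 0 \<omega>) (q 0 \<omega>)) +
             (1 / 2) * trace (transpose \<Sigma> ** \<Sigma>) * (real n * h)"
proof -
  interpret prob_space M by fact
  define G where "G k = F (real k * h)" for k :: nat
  define c where "c = (1 / 2) * trace (transpose \<Sigma> ** \<Sigma>)"
  define H where "H k \<omega> = hamiltonian V (p k \<omega>) (q k \<omega>)" for k \<omega>
  define U where "U k \<omega> = H k \<omega> - c * (real k * h)" for k \<omega>
  define w where "w k \<omega> = W (real (Suc k) * h) \<omega> - W (real k * h) \<omega>" for k \<omega>
  note grad = assms(4) and cont = assms(5) and h = \<open>h > 0\<close>
  have sub: "subalgebra M (G k)" for k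
    using assms(2) h unfolding normal_filtration_def G_def by simp
  have p_meas [measurable]: "p k \<in> borel_measurable (G k)" and [measurable]: "q k \<in> borel_measurable (G k)" for k
    unfolding G_def by fact+
  have "isCont V x" for x
    using grad[of x] unfolding gderiv_def by (rule has_derivative_continuous)
  then have [measurable]: "V \<in> borel_measurable borel"
    by (intro borel_measurable_continuous_onI) (simp add: continuous_on_eq_continuous_at)
  have [measurable]: "(\<lambda>x. x $ j) \<in> borel_measurable borel" for j :: 'm
    by (intro borel_measurable_continuous_onI continuous_intros)
  have U_meas: "U k \<in> borel_measurable (G k)" for k
    unfolding U_def H_def hamiltonian_def by measurable
  then have U_measM [measurable]: "U k \<in> borel_measurable M" for k
    using sub by (metis measurable_from_subalg)
  have centred: "locally_centred M (G k) (\<lambda>\<omega>. U (Suc k) \<omega> - U k \<omega>)" for k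
  proof -
    have times: "0 \<le> real k * h" "real k * h < real (Suc k) * h"
      and diff: "real (Suc k) * h - real k * h = h"
      using h by (auto simp: algebra_simps)
    have "\<forall>s\<ge>0. \<forall>t>s. indep_set (sets (F s)) {(\<lambda>\<omega>. W t \<omega> - W s \<omega>) -` A \<inter> space M | A. A \<in> sets borel} \<and>
        indep_vars (\<lambda>_. borel) (\<lambda>i \<omega>. (W t \<omega> - W s \<omega>) $ i) UNIV \<and>
        (\<forall>i. distributed M lborel (\<lambda>\<omega>. (W t \<omega> - W s \<omega>) $ i) (normal_density 0 (sqrt (t - s))))"
      using assms(3) unfolding brownian_motion_def by (elim conjE)
    note increment = this[rule_format, OF times, unfolded diff, folded G_def w_def]
    have indep: "indep_set (sets (G k)) {w k -` A \<inter> space M | A. A \<in> sets borel}"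
      and comps: "indep_vars (\<lambda>_. borel) (\<lambda>i \<omega>. w k \<omega> $ i) UNIV"
      and normal: "distributed M lborel (\<lambda>\<omega>. w k \<omega> $ i) (normal_density 0 (sqrt h))" for i
      using increment by blast+
    have W: "W (real j * h) \<in> borel_measurable M" for j
    proof -
      have "W (real j * h) \<in> borel_measurable (G j)"
        using assms(3) h unfolding brownian_motion_def G_def by simp
      then show ?thesis using sub by (metis measurable_from_subalg)
    qed
    have w_meas [measurable]: "w k \<in> borel_measurable M"
      unfolding w_def using W by (intro borel_measurable_diff)
    have sqrt_h: "0 < sqrt h" using h by simp
    have int: "integrable M (\<lambda>\<omega>. w k \<omega> $ i)" "expectation (\<lambda>\<omega>. w k \<omega> $ i) = 0"
      "integrable M (\<lambda>\<omega>. (w k \<omega> $ i)\<^sup>2)" "expectation (\<lambda>\<omega>. (w k \<omega> $ i)\<^sup>2) = h" for i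
      using normal_distributed_second_moment[OF sqrt_h normal]
        normal_distributed_expectation[OF sqrt_h normal] h by auto
    note quad = expectation_power2_norm_matrix[OF comps int, of \<Sigma>]
    \<comment> \<open>The quadratic noise term minus its mean: half of
      \<open>trace (transpose \<Sigma> ** \<Sigma>) * h\<close> is \<open>c * h\<close>, which is
      also the compensator added to \<open>U\<close> per step.\<close>
    define f where "f x = (norm (\<Sigma> *v x))\<^sup>2 / 2 - c * h" for x
    have f: "f \<in> borel_measurable borel"
      unfolding f_def by (intro borel_measurable_continuous_onI continuous_intros) auto
    have f_int: "integrable M (\<lambda>\<omega>. f (w k \<omega>))" "expectation (\<lambda>\<omega>. f (w k \<omega>)) = 0"
      unfolding f_def using quad by (auto simp: c_def prob_space)
    have P: "(\<lambda>\<omega>. p k \<omega> v* \<Sigma>) \<in> borel_measurable (G k)"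
    proof (rule measurable_compose[OF p_meas])
      have "continuous_on UNIV (\<lambda>x. x v* \<Sigma>)"
        using linear_continuous_on[OF matrix_vector_mul_bounded_linear[of "transpose \<Sigma>"], of UNIV]
        by (simp only: transpose_matrix_vector[symmetric])
      then show "(\<lambda>x. x v* \<Sigma>) \<in> borel_measurable borel"
        by (rule borel_measurable_continuous_onI)
    qed
    have lin: "locally_centred M (G k) (\<lambda>\<omega>. (p k \<omega> v* \<Sigma>) \<bullet> w k \<omega> + f (w k \<omega>))"
      by (rule locally_centred_linear_combination
          [where P = "\<lambda>\<omega>. p k \<omega> v* \<Sigma>" and w = "w k" and f = f,
            OF indep sub P w_meas f int(1,2) f_int])
    show ?thesis
    proof (rule locally_centred_cong_AE[OF lin sub])
      show "(\<lambda>\<omega>. (p k \<omega> v* \<Sigma>) \<bullet> w k \<omega> + f (w k \<omega>)) \<in> borel_measurable M"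
        using measurable_from_subalg[OF sub P] w_meas measurable_compose[OF w_meas f]
        by (intro borel_measurable_add borel_measurable_inner)
      show "AE \<omega> in M. U (Suc k) \<omega> - U k \<omega> = (p k \<omega> v* \<Sigma>) \<bullet> w k \<omega> + f (w k \<omega>)"
        using assms(9)[of k]
      proof eventually_elim
        case (elim \<omega>)
        from drift_preserving_step_hamiltonian[OF grad cont this] show ?case
          by (simp add: U_def H_def f_def w_def algebra_simps)
      qed
    qed (intro borel_measurable_diff U_measM)
  qed
  have U0: "integrable M (U 0)"
    using assms(10) by (simp add: U_def[abs_def] H_def)
  have "integrable M (H n) \<and> expectation (H n) = expectation (H 0) + c * (real n * h)"
    if "has_expectation M (H n)" for n
  proof -
    have [measurable]: "H n \<in> borel_measurable M"
      using that by (simp add: has_expectation_def)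
    define C where "C = \<bar>c * (real n * h)\<bar>"
    \<comment> \<open>\<open>H n\<close> and \<open>U n\<close> differ by a constant, so a finite
      integral of the positive or negative part passes from one to the other.\<close>
    have shift: "(\<integral>\<^sup>+ \<omega>. ennreal (g \<omega>) \<partial>M) < \<infinity>"
      if "(\<integral>\<^sup>+ \<omega>. ennreal (f \<omega>) \<partial>M) < \<infinity>" "\<And>\<omega>. g \<omega> \<le> f \<omega> + C"
        and [measurable]: "f \<in> borel_measurable M" for f g
    proof -
      have "(\<integral>\<^sup>+ \<omega>. ennreal (g \<omega>) \<partial>M) \<le> (\<integral>\<^sup>+ \<omega>. ennreal (f \<omega>) + ennreal C \<partial>M)"
      proof (rule nn_integral_mono)
        fix \<omega>
        have "ennreal (g \<omega>) \<le> ennreal (max 0 (f \<omega>) + C)"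
          using that(2)[of \<omega>] by (intro ennreal_leI) simp
        also have "\<dots> = ennreal (f \<omega>) + ennreal C"
          by (simp add: C_def ennreal_max_0)
        finally show "ennreal (g \<omega>) \<le> ennreal (f \<omega>) + ennreal C" .
      qed
      also have "\<dots> = (\<integral>\<^sup>+ \<omega>. ennreal (f \<omega>) \<partial>M) + ennreal C"
        by (simp add: nn_integral_add emeasure_space_1)
      also have "\<dots> < \<infinity>" using that(1) by simp
      finally show ?thesis .
    qed
    have "integrable M (U n) \<and> expectation (U n) = expectation (U 0)"
      using that unfolding has_expectation_def
    proof (elim conjE disjE)
      assume "(\<integral>\<^sup>+ \<omega>. ennreal (- H n \<omega>) \<partial>M) < \<infinity>"
      then have "(\<integral>\<^sup>+ \<omega>. ennreal (- U n \<omega>) \<partial>M) < \<infinity>"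
        by (rule shift) (auto simp: U_def C_def)
      then show ?thesis
        by (rule integral_local_martingale_eq_initial[OF prob_space_axioms sub U_meas centred U0])
    next
      \<comment> \<open>Here the positive part is the finite one. The negated process
        \<open>- U\<close> also has locally centred increments, and its negative part is the
        positive part of \<open>U\<close>.\<close>
      assume "(\<integral>\<^sup>+ \<omega>. ennreal (H n \<omega>) \<partial>M) < \<infinity>"
      then have "(\<integral>\<^sup>+ \<omega>. ennreal (- (- U n \<omega>)) \<partial>M) < \<infinity>"
        by (rule shift) (auto simp: U_def C_def)
      then have "integrable M (\<lambda>\<omega>. - U n \<omega>) \<and> expectation (\<lambda>\<omega>. - U n \<omega>) = expectation (\<lambda>\<omega>. - U 0 \<omega>)"
        using U0 U_meas locally_centred_uminus[OF centred]
        by (intro integral_local_martingale_eq_initial[OF prob_space_axioms sub, of "\<lambda>k \<omega>. - U k \<omega>"])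
          (auto simp: algebra_simps)
      then show ?thesis by simp
    qed
    moreover have "H n = (\<lambda>\<omega>. U n \<omega> + c * (real n * h))" "U 0 = H 0"
      by (auto simp: U_def)
    ultimately show ?thesis by (simp add: prob_space)
  qed
  then show ?thesis unfolding H_def[abs_def] c_def by blast
qed

end
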